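(* Let $N$ be a positive integer, $\boldsymbol{\mu}\in\mathbb{R}^N$, and let $\mathbf{\Sigma}=(\Sigma_{ij})$ be a symmetric positive definite $N\times N$ real matrix such that $\sqrt{\Sigma_{11}}<\rho_{1j}\sqrt{\Sigma_{jj}}$ for all $j\neq 1$, where $\rho_{1j}=\Sigma_{1j}/\sqrt{\Sigma_{11}\Sigma_{jj}}$. With $g$, $\alpha(\gamma_{th})$, $P(\gamma_{th})$, $T_{\gamma_{th}}$, $Z_{\gamma_{th}}$ as defined in the context, consider for each $\gamma_{th}>0$ the estimator with $\beta=-1$, $$T'_{\gamma_{th}}(\mathbf{Y})=T_{\gamma_{th}}(\mathbf{Y})-\bigl(Z_{\gamma_{th}}(\mathbf{Y})-P(\gamma_{th})\bigr),\qquad \mathbf{Y}\sim g .$$ Then $T'_{\gamma_{th}}(\mathbf{Y})$ has the asymptotically vanishing relative error property, that is, $$\limsup_{\gamma_{th}\to 0}\frac{\mathrm{var}_g\left[T'_{\gamma_{th}}(\mathbf{Y})\right]}{\alpha^2(\gamma_{th})}=0,$$ where the limit is taken over $\gamma_{th}>0$.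
   Context: Let $f$ be the density of the $N$-dimensional normal distribution with mean vector $\boldsymbol{\mu}=(\mu_1,\dots,\mu_N)^t$ and positive definite covariance matrix $\mathbf{\Sigma}$. For a threshold $\gamma_{th}>0$, define the probability of interest $$\alpha(\gamma_{th})=P_f\Bigl(\sum_{i=1}^N \exp(Y_i)\le\gamma_{th}\Bigr),$$ where $P_f$ means that $\mathbf{Y}=(Y_1,\dots,Y_N)^t$ has density $f$. Define the shift vector $\mathbf{\Lambda}^*=\mathbf{\Lambda}^*(\gamma_{th})\in\mathbb{R}^N$ by $\Lambda^*_k=\frac{\Sigma_{k1}}{\Sigma_{11}}(\log(\gamma_{th})-\mu_1)$ for $k=1,\dots,N$ (in particular $\Lambda_1^*=\log(\gamma_{th})-\mu_1$). Let $g=g_{\gamma_{th}}$ be the density of the $N$-dimensional normal distribution with mean $\boldsymbol{\mu}+\mathbf{\Lambda}^*$ and covariance matrix $\mathbf{\Sigma}$; $\mathbb{E}_g$, $\mathrm{var}_g$ denote expectation and variance when $\mathbf{Y}$ has density $g$. The likelihood ratio is $$L(\mathbf{Y})=\frac{f(\mathbf{Y})}{g(\mathbf{Y})}=\exp\Bigl(-(\mathbf{\Lambda}^* )^t\mathbf{\Sigma}^{-1}(\mathbf{Y}-\boldsymbol{\mu})+\tfrac12(\mathbf{\Lambda}^* )^t\mathbf{\Sigma}^{-1}\mathbf{\Lambda}^*\Bigr).$$ Define $$T_{\gamma_{th}}(\mathbf{Y})=\mathbf{1}_{\left(\sum_{i=1}^N\exp(Y_i)\le\gamma_{th}\right)}L(\mathbf{Y}),\qquad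 Z_{\gamma_{th}}(\mathbf{Y})=\mathbf{1}_{\left(\exp(Y_1)\le\gamma_{th}\right)}L(\mathbf{Y}),$$ and $$P(\gamma_{th})=\mathbb{E}_g[Z_{\gamma_{th}}(\mathbf{Y})]=P_f(\exp(Y_1)\le\gamma_{th})=\Phi\Bigl(\frac{\log(\gamma_{th})-\mu_1}{\sqrt{\Sigma_{11}}}\Bigr),$$ where $\Phi$ is the standard normal cumulative distribution function. *)

theory Defs
  imports "HOL-Probability.Probability"
begin

(* Positive definiteness includes symmetry here. *)
definition pos_def_matrix :: "real^'n^'n \<Rightarrow> bool" where
  "pos_def_matrix S \<longleftrightarrow> transpose S = S \<and> (\<forall>x. x \<noteq> 0 \<longrightarrow> 0 < x \<bullet> (S *v x))"

definition mvn_density :: "real^'n \<Rightarrow> real^'n^'n \<Rightarrow> real^'n \<Rightarrow> real" where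
  "mvn_density \<mu> S y =
     exp (- ((y - \<mu>) \<bullet> (matrix_inv S *v (y - \<mu>))) / 2) / sqrt ((2 * pi) ^ CARD('n) * det S)"

definition mvn :: "real^'n \<Rightarrow> real^'n^'n \<Rightarrow> (real^'n) measure" where
  "mvn \<mu> S = density lborel (\<lambda>y. ennreal (mvn_density \<mu> S y))"

definition correlation :: "real^'n^'n \<Rightarrow> 'n \<Rightarrow> 'n \<Rightarrow> real" where
  "correlation S i j = S $ i $ j / sqrt (S $ i $ i * S $ j $ j)"

definition left_tail :: "real^'n \<Rightarrow> real^'n^'n \<Rightarrow> real \<Rightarrow> real" where
  "left_tail \<mu> S \<gamma> = measure (mvn \<mu> S) {y. (\<Sum>k\<in>UNIV. exp (y $ k)) \<le> \<gamma>}"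

(* The index i singles out the component that drives the shift and the control variate (the first
   one in the usual numbering); \<gamma> is the threshold. *)
definition shift :: "real^'n \<Rightarrow> real^'n^'n \<Rightarrow> 'n \<Rightarrow> real \<Rightarrow> real^'n" where
  "shift \<mu> S i \<gamma> = (\<chi> k. S $ k $ i / S $ i $ i * (ln \<gamma> - \<mu> $ i))"

definition proposal :: "real^'n \<Rightarrow> real^'n^'n \<Rightarrow> 'n \<Rightarrow> real \<Rightarrow> (real^'n) measure" where
  "proposal \<mu> S i \<gamma> = mvn (\<mu> + shift \<mu> S i \<gamma>) S"

definition likelihood_ratio :: "real^'n \<Rightarrow> real^'n^'n \<Rightarrow> 'n \<Rightarrow> real \<Rightarrow> real^'n \<Rightarrow> real" where
  "likelihood_ratio \<mu> S i \<gamma> y = mvn_density \<mu> S y / mvn_density (\<mu> + shift \<mu> S i \<gamma>) S y"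

definition importance_estimator :: "real^'n \<Rightarrow> real^'n^'n \<Rightarrow> 'n \<Rightarrow> real \<Rightarrow> real^'n \<Rightarrow> real" where
  "importance_estimator \<mu> S i \<gamma> y =
     indicator {y. (\<Sum>k\<in>UNIV. exp (y $ k)) \<le> \<gamma>} y * likelihood_ratio \<mu> S i \<gamma> y"

definition control_variate :: "real^'n \<Rightarrow> real^'n^'n \<Rightarrow> 'n \<Rightarrow> real \<Rightarrow> real^'n \<Rightarrow> real" where
  "control_variate \<mu> S i \<gamma> y =
     indicator {y. exp (y $ i) \<le> \<gamma>} y * likelihood_ratio \<mu> S i \<gamma> y"

definition control_mean :: "real^'n \<Rightarrow> real^'n^'n \<Rightarrow> 'n \<Rightarrow> real \<Rightarrow> real" where
  "control_mean \<mu> S i \<gamma> =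
     prob_space.expectation (proposal \<mu> S i \<gamma>) (control_variate \<mu> S i \<gamma>)"

definition cv_estimator :: "real^'n \<Rightarrow> real^'n^'n \<Rightarrow> 'n \<Rightarrow> real \<Rightarrow> real^'n \<Rightarrow> real" where
  "cv_estimator \<mu> S i \<gamma> y =
     importance_estimator \<mu> S i \<gamma> y - (control_variate \<mu> S i \<gamma> y - control_mean \<mu> S i \<gamma>)"

end

theory Submission
  imports Defs
begin

text \<open>
  Write \<open>a = ln \<gamma> - \<mu>\<^sub>i\<close>, \<open>\<sigma> = S\<^sub>i\<^sub>i\<close> and \<open>M = exp (- a\<^sup>2 / (2\<sigma>))\<close>. The shift is the mean change produced by tilting along
  the i-th axis, so the likelihood ratio only depends on the i-th coordinate and is at most \<open>M\<close> where
  \<open>exp (y\<^sub>i) \<le> \<gamma>\<close>. The estimator equals a constant minus the likelihood ratio on the event \<open>B\<close> that the i-th summand is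
  below the threshold but the sum is above it, hence its variance is at most \<open>M\<^sup>2\<close> times the
  proposal probability of \<open>B\<close>. Under the proposal the i-th coordinate is centred at \<open>ln \<gamma>\<close>, while every other coordinate
  has mean \<open>S\<^sub>i\<^sub>j/\<sigma> a + O(1)\<close> with \<open>S\<^sub>i\<^sub>j/\<sigma> > 1\<close>. So on \<open>B\<close> either the i-th coordinate is
  within \<open>2 exp (\<epsilon> a)\<close> of \<open>ln \<gamma>\<close> or some other coordinate is of order \<open>\<bar>a\<bar>\<close> above its mean; both have
  probability \<open>O(exp (\<epsilon> a))\<close>. Conversely, tilting to a mean slightly below the threshold and using only a small ball
  around that mean, the left tail is at least a constant times \<open>M exp (\<epsilon> a / 4)\<close>. The relative error is thus
  \<open>O(exp (\<epsilon> a / 2))\<close>.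
\<close>

section \<open>Gaussian integrals\<close>

text \<open>The map inside \<open>h\<close> overwrites the \<open>b\<close>-coordinate of
  \<open>x\<close> by \<open>r \<bullet> x\<close> and keeps all others. By Fubini the
  \<open>b\<close>-coordinate may be integrated first, and on each line parallel to \<open>b\<close>
  the map is affine with slope \<open>r \<bullet> b\<close>. This is the change of variables behind
  completing the square in one coordinate.\<close>

lemma nn_integral_lborel_replace_coordinate:
  fixes r b :: "'a::euclidean_space" and h :: "'a \<Rightarrow> ennreal"
  assumes b: "b \<in> Basis" and r: "r \<bullet> b \<noteq> 0" and [measurable]: "h \<in> borel_measurable borel"
  shows "ennreal \<bar>r \<bullet> b\<bar> * (\<integral>\<^sup>+x. h (x + (r \<bullet> x - x \<bullet> b) *\<^sub>R b) \<partial>lborel) = (\<integral>\<^sup>+x. h x \<partial>lborel)"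
proof -
  define I where "I = (Basis - {b} :: 'a set)"
  have I: "finite I" "b \<notin> I" "insert b I = Basis" using b by (auto simp: I_def)
  define \<Phi> where "\<Phi> f = (\<Sum>d\<in>Basis. f d *\<^sub>R d)" for f :: "'a \<Rightarrow> real"
  interpret product_sigma_finite "\<lambda>d::'a. lborel :: real measure" ..
  have upd: "\<Phi> (f(b := t)) = (\<Sum>d\<in>I. f d *\<^sub>R d) + t *\<^sub>R b" for f t
  proof -
    have "(\<Sum>d\<in>I. (f(b := t)) d *\<^sub>R d) = (\<Sum>d\<in>I. f d *\<^sub>R d)"
      using I(2) by (intro sum.cong) auto
    then show ?thesis unfolding \<Phi>_def I(3)[symmetric] sum.insert[OF I(1,2)] by (simp add: add.commute)
  qed
  have [measurable]: "\<Phi> \<in> (\<Pi>\<^sub>M d\<in>insert b I. lborel) \<rightarrow>\<^sub>M borel"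
    unfolding \<Phi>_def I(3) by measurable
  have lb: "(\<integral>\<^sup>+x. g x \<partial>lborel) = (\<integral>\<^sup>+f. (\<integral>\<^sup>+t. g (\<Phi> (f(b := t))) \<partial>lborel) \<partial>(\<Pi>\<^sub>M d\<in>I. lborel))"
    if [measurable]: "g \<in> borel_measurable borel" for g :: "'a \<Rightarrow> ennreal"
  proof -
    have "(\<integral>\<^sup>+x. g x \<partial>lborel) = (\<integral>\<^sup>+f. g (\<Phi> f) \<partial>(\<Pi>\<^sub>M d\<in>insert b I. lborel))"
      unfolding \<Phi>_def I(3) by (subst lborel_eq) (simp add: nn_integral_distr)
    also have "\<dots> = (\<integral>\<^sup>+f. (\<integral>\<^sup>+t. g (\<Phi> (f(b := t))) \<partial>lborel) \<partial>(\<Pi>\<^sub>M d\<in>I. lborel))"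
    proof (rule product_nn_integral_insert[OF I(1,2)])
      show "(\<lambda>f. g (\<Phi> f)) \<in> borel_measurable (\<Pi>\<^sub>M d\<in>insert b I. lborel)" by measurable
    qed
    finally show ?thesis .
  qed
  have [simp]: "(\<Sum>d\<in>I. f d *\<^sub>R d) \<bullet> b = 0" for f
    unfolding inner_sum_left using b by (intro sum.neutral) (auto simp: I_def inner_Basis)
  have [simp]: "b \<bullet> b = 1" using b by (simp add: inner_Basis)
  have inner: "ennreal \<bar>r \<bullet> b\<bar> * (\<integral>\<^sup>+t. h (\<Phi> (f(b := t)) + (r \<bullet> \<Phi> (f(b := t)) - \<Phi> (f(b := t)) \<bullet> b) *\<^sub>R b) \<partial>lborel)
     = (\<integral>\<^sup>+t. h (\<Phi> (f(b := t))) \<partial>lborel)" for f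
  proof -
    define s where "s = (\<Sum>d\<in>I. f d *\<^sub>R d)"
    have "(\<integral>\<^sup>+t. h (s + t *\<^sub>R b) \<partial>lborel) = ennreal \<bar>r \<bullet> b\<bar> * (\<integral>\<^sup>+t. h (s + (r \<bullet> s + (r \<bullet> b) * t) *\<^sub>R b) \<partial>lborel)"
      by (rule nn_integral_real_affine) (use r in auto)
    note affine = this
    have eq: "\<Phi> (f(b := t)) + (r \<bullet> \<Phi> (f(b := t)) - \<Phi> (f(b := t)) \<bullet> b) *\<^sub>R b = s + (r \<bullet> s + (r \<bullet> b) * t) *\<^sub>R b" for t
    proof -
      have "s \<bullet> b = 0" by (simp add: s_def)
      then have "r \<bullet> (s + t *\<^sub>R b) - (s + t *\<^sub>R b) \<bullet> b = (r \<bullet> s + (r \<bullet> b) * t) - t"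
        by (simp add: inner_add_left inner_add_right)
      then show ?thesis by (simp add: upd s_def[symmetric] scaleR_left_diff_distrib)
    qed
    show ?thesis unfolding eq unfolding upd s_def[symmetric] affine ..
  qed
  show ?thesis
    by (subst (1 2) lb, measurable, subst nn_integral_cmult[symmetric]) (auto simp: inner)
qed

section \<open>One-dimensional and isotropic Gaussian integrals\<close>

lemma nn_integral_gaussian:
  fixes l :: real
  assumes l: "0 < l"
  shows "(\<integral>\<^sup>+t. ennreal (exp (- (l * t\<^sup>2))) \<partial>lborel) = ennreal (sqrt (pi / l))"
proof -
  define s where "s = sqrt (1 / (2 * l))"
  have s: "s > 0" "s\<^sup>2 = 1 / (2 * l)" using l by (auto simp: s_def)
  have nd: "exp (- (l * t\<^sup>2)) = sqrt (pi / l) * normal_density 0 s t" for t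
    unfolding normal_density_def s(2) using l by (simp add: field_simps)
  interpret prob_space "density lborel (normal_density 0 s)"
    using s by (intro prob_space_normal_density)
  have "(\<integral>\<^sup>+t. ennreal (normal_density 0 s t) \<partial>lborel) = 1"
    using emeasure_space_1 by (simp add: emeasure_density)
  then show ?thesis unfolding nd using l
    by (simp add: ennreal_mult nn_integral_cmult)
qed

text \<open>The Gaussian weight factorises over the coordinates, and \<open>g\<close> only joins the
  factor of coordinate \<open>k\<close>. It serves twice: \<open>g = 1\<close> gives the standard
  Gaussian integral, and the indicator of an interval gives the slab estimate
  \<open>mvn_slab_le\<close>.\<close>

lemma nn_integral_lborel_axis_cutoff:
  fixes k :: "'n::finite" and g :: "real \<Rightarrow> ennreal"
  assumes [measurable]: "g \<in> borel_measurable borel" and l: "0 < l"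
  shows "(\<integral>\<^sup>+x. g (x $ k) * ennreal (exp (- (l * (x \<bullet> x)))) \<partial>(lborel :: (real^'n) measure))
    = (\<integral>\<^sup>+t. g t * ennreal (exp (- (l * t\<^sup>2))) \<partial>lborel) * ennreal (sqrt (pi / l)) ^ (CARD('n) - 1)"
proof -
  define f where "f b t = (if b = axis k 1 then g t else 1) * ennreal (exp (- (l * t\<^sup>2)))" for b :: "real^'n" and t
  have kB: "axis k 1 \<in> (Basis :: (real^'n) set)" by (simp add: axis_in_Basis_iff)
  have prod_f: "g (x $ k) * ennreal (exp (- (l * (x \<bullet> x)))) = (\<Prod>b\<in>Basis. f b (x \<bullet> b))" for x :: "real^'n"
  proof -
    have "(\<Prod>b\<in>Basis. f b (x \<bullet> b)) = (\<Prod>b\<in>Basis. if b = axis k 1 then g (x \<bullet> b) else 1)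
       * (\<Prod>b\<in>Basis. ennreal (exp (- (l * (x \<bullet> b)\<^sup>2))))"
      by (simp add: f_def prod.distrib)
    also have "(\<Prod>b\<in>Basis. if b = axis k 1 then g (x \<bullet> b) else 1) = g (x $ k)"
      using kB by (subst prod.delta) (auto simp: inner_axis)
    also have "(\<Prod>b\<in>Basis. ennreal (exp (- (l * (x \<bullet> b)\<^sup>2)))) = ennreal (exp (- (l * (x \<bullet> x))))"
      by (subst euclidean_inner) (simp add: prod_ennreal exp_sum[symmetric] sum_negf sum_distrib_left power2_eq_square)
    finally show ?thesis by simp
  qed
  have "(\<integral>\<^sup>+x. g (x $ k) * ennreal (exp (- (l * (x \<bullet> x)))) \<partial>(lborel :: (real^'n) measure))
     = (\<Prod>b\<in>(Basis::(real^'n) set). (\<integral>\<^sup>+t. f b t \<partial>lborel))"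
    unfolding prod_f by (rule nn_integral_lborel_prod) (auto simp: f_def)
  also have "\<dots> = (\<integral>\<^sup>+t. f (axis k 1) t \<partial>lborel) * (\<Prod>b\<in>(Basis::(real^'n) set) - {axis k 1}. (\<integral>\<^sup>+t. f b t \<partial>lborel))"
    using kB by (subst prod.remove) auto
  also have "(\<Prod>b\<in>(Basis::(real^'n) set) - {axis k 1}. (\<integral>\<^sup>+t. f b t \<partial>lborel)) =
     (\<Prod>b\<in>(Basis::(real^'n) set) - {axis k 1}. ennreal (sqrt (pi / l)))"
    by (rule prod.cong) (auto simp: f_def nn_integral_gaussian[OF l])
  also have "\<dots> = ennreal (sqrt (pi / l)) ^ (CARD('n) - 1)"
    using kB by (simp add: card_Diff_singleton)
  finally show ?thesis by (simp add: f_def)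
qed

lemma nn_integral_std_gaussian:
  "(\<integral>\<^sup>+x. ennreal (exp (- (x \<bullet> x) / 2)) \<partial>(lborel :: (real^'n) measure)) = ennreal (sqrt ((2 * pi) ^ CARD('n)))"
proof -
  have "(\<integral>\<^sup>+x. ennreal (exp (- (x \<bullet> x) / 2)) \<partial>(lborel :: (real^'n) measure))
     = ennreal (sqrt (2 * pi)) * ennreal (sqrt (2 * pi)) ^ (CARD('n) - 1)"
    using nn_integral_lborel_axis_cutoff[of "\<lambda>_. 1" "1/2", where 'n='n] nn_integral_gaussian[of "1/2"] by (simp add: mult.commute)
  also have "\<dots> = ennreal (sqrt (2 * pi)) ^ CARD('n)"
    by (simp add: power_eq_if)
  also have "\<dots> = ennreal (sqrt (2 * pi) ^ CARD('n))"
    by (rule ennreal_power) simp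
  finally show ?thesis by (simp only: real_sqrt_power)
qed

section \<open>Positive definite matrices: Gaussian integral, determinant and inverse\<close>

lemma sym_matrix_inner_commute:
  fixes A :: "real^'n^'n"
  assumes "transpose A = A"
  shows "x \<bullet> (A *v y) = y \<bullet> (A *v x)"
  using dot_lmul_matrix[of x A y] assms by (metis inner_commute transpose_matrix_vector)

lemma quadratic_form_borel_measurable [measurable]:
  "(\<lambda>x. x \<bullet> ((A :: real^'n^'n) *v x)) \<in> borel_measurable borel"
  by (intro borel_measurable_continuous_onI continuous_intros)

text \<open>Induction on a set J outside of which the matrix already is the identity: completing the square in
  one coordinate of J turns that row and column into the identity, too.\<close>

lemma pos_def_gaussian_integral_aux:
  fixes B :: "real^'n^'n"
  assumes "finite J" "pos_def_matrix B"
    and "\<And>k l. k \<notin> J \<or> l \<notin> J \<Longrightarrow> B $ k $ l = (if k = l then 1 else 0)"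
  shows "0 < det B \<and> ennreal (sqrt (det B)) * (\<integral>\<^sup>+x. ennreal (exp (- (x \<bullet> (B *v x)) / 2)) \<partial>lborel)
     = ennreal (sqrt ((2 * pi) ^ CARD('n)))"
  using assms
proof (induction J arbitrary: B rule: finite_induct)
  case empty
  then have "B = mat 1" by (simp add: vec_eq_iff mat_def)
  then show ?case using nn_integral_std_gaussian[where 'n='n] by simp
next
  case (insert k J)
  define \<beta> where "\<beta> = B $ k $ k"
  have sym: "transpose B = B" using insert.prems(1) by (simp add: pos_def_matrix_def)
  have symB: "B $ p $ q = B $ q $ p" for p q
    by (metis sym transpose_def vec_lambda_beta)
  have "axis k 1 \<bullet> (B *v axis k 1) > 0"
    using insert.prems(1) by (auto simp: pos_def_matrix_def axis_eq_0_iff)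
  then have \<beta>: "\<beta> > 0"
    by (simp add: \<beta>_def matrix_vector_mul_component inner_axis inner_axis' column_def)
  \<comment> \<open>Completing the square: \<open>B\<close>'s form at \<open>y\<close> is
    \<open>\<beta>\<close> times the square of \<open>y $ k\<close> plus the sum of
    \<open>B $ k $ l * y $ l / \<beta>\<close> over \<open>l \<noteq> k\<close>, plus terms free of
    \<open>y $ k\<close>. Putting \<open>y $ k = \<rho> \<bullet> x\<close> turns the square term
    into exactly the square of \<open>x $ k\<close>.\<close>
  define \<rho> :: "real^'n" where "\<rho> = (\<chi> l. if l = k then 1 / sqrt \<beta> else - B $ k $ l / \<beta>)"
  define R :: "real^'n^'n" where "R = (\<chi> p. if p = k then \<rho> else axis p 1)"
  have ax: "axis i (1::real) $ p = (if p = i then 1 else 0)" for i p :: 'n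
    by (simp add: axis_def)
  have Rv: "R *v x = x + (\<rho> \<bullet> x - x \<bullet> axis k 1) *\<^sub>R axis k 1" for x
    by (auto simp: vec_eq_iff ax R_def matrix_vector_mul_component inner_axis inner_axis')
  have detR: "det R = 1 / sqrt \<beta>"
  proof -
    \<comment> \<open>\<open>R\<close> is the identity with row \<open>k\<close> replaced by
      \<open>\<rho>\<close>, so Cramer's rule gives the determinant
      \<open>\<rho> $ k\<close>.\<close>
    have "R = (\<chi> p. if p = k then (\<Sum>l\<in>UNIV. \<rho> $ l *s row l (mat 1)) else row p (mat 1))"
      by (auto simp: vec_eq_iff R_def row_def mat_def ax if_distrib cong: if_cong)
    then show ?thesis
      by (simp only: cramer_lemma_transpose) (simp add: \<rho>_def)
  qed
  define C where "C = transpose R ** B ** R"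
  have Cq: "x \<bullet> (C *v y) = (R *v x) \<bullet> (B *v (R *v y))" for x y
    using dot_lmul_matrix[of "B *v (R *v y)" R x]
    by (metis C_def inner_commute matrix_vector_mul_assoc transpose_matrix_vector)
  have inj: "R *v x = 0 \<Longrightarrow> x = 0" for x
    using detR \<beta> by (metis det_nz_iff_inj invertible_det_nz matrix_left_invertible_ker invertible_left_inverse div_by_0 divide_eq_0_iff less_irrefl real_sqrt_eq_zero_cancel_iff zero_neq_one)
  have pdC: "pos_def_matrix C"
    unfolding pos_def_matrix_def
  proof (intro conjI allI impI)
    show "transpose C = C" unfolding C_def
      by (simp add: matrix_transpose_mul sym matrix_mul_assoc)
    show "0 < x \<bullet> (C *v x)" if "x \<noteq> 0" for x
      unfolding Cq using insert.prems(1) inj that by (auto simp: pos_def_matrix_def)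
  qed
  have Centry: "C $ p $ q = (R *v axis p 1) \<bullet> (B *v (R *v axis q 1))" for p q
    unfolding Cq[symmetric] by (simp add: inner_axis' matrix_vector_mul_component inner_axis)
  have Raxis: "R *v axis q 1 = (if q = k then (1 / sqrt \<beta>) *\<^sub>R axis k 1 else axis q 1 - (B $ k $ q / \<beta>) *\<^sub>R axis k 1)" for q
    unfolding Rv by (auto simp: \<rho>_def inner_axis inner_axis' ax vec_eq_iff)
  have Baxis: "axis p 1 \<bullet> (B *v axis q 1) = B $ p $ q" for p q
    by (simp add: inner_axis' matrix_vector_mul_component inner_axis)
  have sq: "sqrt \<beta> * sqrt \<beta> = \<beta>" using \<beta> by simp
  have Ck: "C $ p $ k = (if p = k then 1 else 0)" for p
  proof (cases "p = k")
    case True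
    have "C $ k $ k = (1 / sqrt \<beta>) * ((1 / sqrt \<beta>) * \<beta>)"
      unfolding Centry Raxis by (simp add: Baxis matrix_vector_mult_scaleR \<beta>_def)
    also have "\<dots> = 1" using \<beta> sq by (simp add: field_simps)
    finally show ?thesis using True by simp
  next
    case False
    then have "C $ p $ k = (1 / sqrt \<beta>) * (B $ p $ k - (B $ k $ p / \<beta>) * \<beta>)"
      unfolding Centry Raxis by (simp add: Baxis matrix_vector_mult_scaleR inner_diff_left \<beta>_def)
    also have "\<dots> = 0" using \<beta> symB[of p k] by simp
    finally show ?thesis using False by simp
  qed
  have symC: "C $ p $ q = C $ q $ p" for p q
  proof -
    have "transpose C $ p $ q = C $ p $ q" using pdC by (simp add: pos_def_matrix_def)
    then show ?thesis by (simp add: transpose_def)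
  qed
  \<comment> \<open>Index \<open>k\<close> is settled by \<open>Ck\<close>. Any other
    \<open>p\<close> outside \<open>J\<close> already has an identity row in \<open>B\<close>, so
    \<open>B $ k $ p = 0\<close>, \<open>R\<close> fixes that axis, and the row survives the
    congruence.\<close>
  have Cp: "C $ p $ q = (if p = q then 1 else 0)" if "p \<notin> J" for p q
  proof (cases "p = k \<or> q = k")
    case True
    then show ?thesis using Ck[of p] Ck[of q] symC[of p q] by auto
  next
    case False
    then have "B $ k $ p = 0" "B $ p $ k = 0" "B $ p $ q = (if p = q then 1 else 0)"
      using that insert.prems(2)[of p q] insert.prems(2)[of p k] insert.prems(2)[of k p] by auto
    with False show ?thesis
      unfolding Centry Raxis
      by (simp add: Baxis inner_diff_right matrix_vector_mult_scaleR matrix_vector_mult_diff_distrib)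
  qed
  then have C_id: "C $ p $ q = (if p = q then 1 else 0)" if "p \<notin> J \<or> q \<notin> J" for p q
    using that symC[of p q] by auto
  note IH = insert.IH[OF pdC C_id]
  have detB: "det B = \<beta> * det C"
    unfolding C_def det_mul det_transpose detR using \<beta> sq by (simp add: field_simps)
  define h where "h x = ennreal (exp (- (x \<bullet> (B *v x)) / 2))" for x
  have [measurable]: "h \<in> borel_measurable borel" unfolding h_def by measurable
  have "ennreal \<bar>\<rho> \<bullet> axis k 1\<bar> * (\<integral>\<^sup>+x. h (x + (\<rho> \<bullet> x - x \<bullet> axis k 1) *\<^sub>R axis k 1) \<partial>lborel) = (\<integral>\<^sup>+x. h x \<partial>lborel)"
    by (rule nn_integral_lborel_replace_coordinate)
       (use \<beta> in \<open>auto simp: axis_in_Basis_iff inner_axis \<rho>_def\<close>)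
  then have "(\<integral>\<^sup>+x. h x \<partial>lborel) = ennreal (1 / sqrt \<beta>) * (\<integral>\<^sup>+x. ennreal (exp (- (x \<bullet> (C *v x)) / 2)) \<partial>lborel)"
    using \<beta> unfolding Rv[symmetric] h_def Cq by (simp add: inner_axis \<rho>_def)
  \<comment> \<open>The Jacobian factor \<open>1 / sqrt \<beta>\<close> is offset by
    \<open>det B = \<beta> * det C\<close>, so the product of root determinant and integral is the
    same for \<open>B\<close> and \<open>C\<close>.\<close>
  moreover have "ennreal (sqrt (det B)) * ennreal (1 / sqrt \<beta>) = ennreal (sqrt (det C))"
    using \<beta> IH by (simp add: detB ennreal_mult[symmetric] real_sqrt_mult)
  ultimately show ?case
    using IH \<beta> by (simp add: detB h_def mult.assoc[symmetric])
qed

text \<open>A by-product of the same induction: each step changes the determinant by a factor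
  \<open>\<beta> > 0\<close>, and the process ends at the identity.\<close>

lemma pos_def_matrix_det_pos: "pos_def_matrix B \<Longrightarrow> 0 < det (B :: real^'n^'n)"
  using pos_def_gaussian_integral_aux[of UNIV B] by auto

lemma pos_def_gaussian_integral:
  fixes B :: "real^'n^'n"
  assumes "pos_def_matrix B"
  shows "ennreal (sqrt (det B)) * (\<integral>\<^sup>+x. ennreal (exp (- (x \<bullet> (B *v x)) / 2)) \<partial>lborel)
     = ennreal (sqrt ((2 * pi) ^ CARD('n)))"
  using pos_def_gaussian_integral_aux[of UNIV B] assms by auto

lemma pos_def_matrix_inv:
  fixes S :: "real^'n^'n"
  assumes "pos_def_matrix S"
  shows "S ** matrix_inv S = mat 1" "matrix_inv S ** S = mat 1" "pos_def_matrix (matrix_inv S)"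
    "det (matrix_inv S) = inverse (det S)"
proof -
  have inv: "invertible S" using pos_def_matrix_det_pos[OF assms] by (simp add: invertible_det_nz)
  show 1: "S ** matrix_inv S = mat 1" "matrix_inv S ** S = mat 1"
    using inv unfolding invertible_def matrix_inv_def by (metis (mono_tags, lifting) someI_ex)+
  have S: "transpose S = S" using assms by (simp add: pos_def_matrix_def)
  have "transpose (matrix_inv S) = transpose (matrix_inv S) ** (S ** matrix_inv S)" by (simp add: 1)
  also have "\<dots> = transpose (S ** matrix_inv S) ** matrix_inv S"
    by (simp only: matrix_transpose_mul S matrix_mul_assoc)
  finally have T: "transpose (matrix_inv S) = matrix_inv S" by (simp add: 1)
  show "pos_def_matrix (matrix_inv S)" unfolding pos_def_matrix_def
  proof (intro conjI allI impI T)
    fix x :: "real^'n" assume x: "x \<noteq> 0"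
    define z where "z = matrix_inv S *v x"
    have Sz: "S *v z = x" unfolding z_def by (simp add: matrix_vector_mul_assoc 1)
    then have "z \<noteq> 0" using x by auto
    then have "0 < z \<bullet> (S *v z)" using assms by (simp add: pos_def_matrix_def)
    then show "0 < x \<bullet> (matrix_inv S *v x)" unfolding Sz by (metis inner_commute z_def)
  qed
  have "det S * det (matrix_inv S) = 1" using det_mul[of S "matrix_inv S"] by (simp add: 1)
  then show "det (matrix_inv S) = inverse (det S)" by (simp add: inverse_unique)
qed

section \<open>The multivariate normal distribution\<close>

lemma matrix_vector_mult_axis: "((S :: real^'n^'n) *v axis i r) $ k = S $ k $ i * r"
  by (simp add: matrix_vector_mul_component inner_axis)

lemma pos_def_matrix_diag_pos:
  assumes "pos_def_matrix S"
  shows "0 < S $ i $ i"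
proof -
  have "0 < axis i 1 \<bullet> (S *v axis i 1)"
    using assms by (auto simp: pos_def_matrix_def axis_eq_0_iff)
  then show ?thesis by (simp add: inner_axis' matrix_vector_mult_axis)
qed

lemma mvn_density_pos: "pos_def_matrix S \<Longrightarrow> 0 < mvn_density \<mu> S y"
  by (simp add: mvn_density_def pos_def_matrix_det_pos)

lemma mvn_density_borel_measurable [measurable]: "mvn_density \<mu> S \<in> borel_measurable borel"
proof -
  have "(\<lambda>y. (y - \<mu>) \<bullet> (matrix_inv S *v (y - \<mu>))) \<in> borel_measurable borel"
    by (rule measurable_compose[OF _ quadratic_form_borel_measurable]) simp
  then show ?thesis unfolding mvn_density_def[abs_def] by measurable
qed

lemma sets_mvn [simp, measurable_cong]: "sets (mvn \<mu> S) = sets borel"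
  by (simp add: mvn_def)

lemma space_mvn [simp]: "space (mvn \<mu> S) = UNIV"
  by (simp add: mvn_def)

text \<open>Reduction to mean zero, which makes later estimates uniform in the mean; the proposal's
  mean moves with the threshold.\<close>

lemma mvn_translate: "mvn (m + \<mu>) S = distr (mvn \<mu> S) borel ((+) m)"
proof -
  have eq: "mvn_density (m + \<mu>) S (m + x) = mvn_density \<mu> S x" for x
    by (simp add: mvn_density_def)
  have "density (distr lborel borel ((+) m)) (\<lambda>y. ennreal (mvn_density (m + \<mu>) S y))
      = distr (density lborel (\<lambda>y. ennreal (mvn_density \<mu> S y))) borel ((+) m)"
    by (subst density_distr) (auto simp: eq)
  then show ?thesis by (simp add: lborel_distr_plus mvn_def)
qed

lemma prob_space_mvn:
  fixes S :: "real^'n^'n"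
  assumes S: "pos_def_matrix S"
  shows "prob_space (mvn \<mu> S)"
proof -
  let ?A = "matrix_inv S"
  let ?I = "\<integral>\<^sup>+x. ennreal (exp (- (x \<bullet> (?A *v x)) / 2)) \<partial>lborel"
  have d: "det S > 0" by (rule pos_def_matrix_det_pos[OF S])
  have "ennreal (sqrt (inverse (det S))) * ?I = ennreal (sqrt ((2 * pi) ^ CARD('n)))"
    using pos_def_gaussian_integral[OF pos_def_matrix_inv(3)[OF S]] by (simp add: pos_def_matrix_inv(4)[OF S])
  then have "ennreal (1 / sqrt ((2 * pi) ^ CARD('n))) * (ennreal (sqrt (inverse (det S))) * ?I)
      = ennreal (1 / sqrt ((2 * pi) ^ CARD('n))) * ennreal (sqrt ((2 * pi) ^ CARD('n)))" by simp
  also have "\<dots> = 1" by (subst ennreal_mult[symmetric]) auto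
  also have "ennreal (1 / sqrt ((2 * pi) ^ CARD('n))) * (ennreal (sqrt (inverse (det S))) * ?I)
     = ennreal (1 / sqrt ((2 * pi) ^ CARD('n) * det S)) * ?I"
  proof -
    have "1 / sqrt ((2 * pi) ^ CARD('n) * det S) = 1 / sqrt ((2 * pi) ^ CARD('n)) * sqrt (inverse (det S))"
      unfolding real_sqrt_mult[of _ "det S"] real_sqrt_inverse by (simp add: divide_inverse)
    moreover have "ennreal (1 / sqrt ((2 * pi) ^ CARD('n)) * sqrt (inverse (det S)))
       = ennreal (1 / sqrt ((2 * pi) ^ CARD('n))) * ennreal (sqrt (inverse (det S)))"
      using d by (intro ennreal_mult) auto
    ultimately show ?thesis by (simp only: mult.assoc)
  qed
  also have "\<dots> = (\<integral>\<^sup>+x. ennreal (mvn_density 0 S x) \<partial>lborel)"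
    using d by (subst nn_integral_cmult[symmetric]) (auto simp: mvn_density_def ennreal_mult[symmetric] intro!: nn_integral_cong)
  finally have "prob_space (mvn 0 S)"
    by (intro prob_spaceI) (simp add: mvn_def emeasure_density)
  then have "prob_space (distr (mvn 0 S) borel ((+) \<mu>))"
    by (rule prob_space.prob_space_distr) simp
  then show ?thesis using mvn_translate[of \<mu> 0 S] by simp
qed

text \<open>A mean shift of the form \<open>S *v u\<close> is an exponential tilt in direction
  \<open>u\<close>: the inverse matrix cancels \<open>S\<close> in the cross term, so the exponent
  changes by an affine function of \<open>y\<close>. The likelihood ratio, the upper tail bound and
  the lower bound for \<open>left_tail\<close> all rest on this.\<close>

lemma mvn_density_tilt:
  fixes S :: "real^'n^'n"
  assumes S: "pos_def_matrix S"
  shows "mvn_density (\<mu> + S *v u) S y = exp (u \<bullet> (y - \<mu>) - u \<bullet> (S *v u) / 2) * mvn_density \<mu> S y"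
proof -
  define A where "A = matrix_inv S"
  define w where "w = y - \<mu>"
  note A = pos_def_matrix_inv[OF S, folded A_def]
  have ASu: "A *v (S *v u) = u" by (simp add: matrix_vector_mul_assoc A)
  have symA: "(S *v u) \<bullet> (A *v w) = w \<bullet> u"
    using sym_matrix_inner_commute[of A "S *v u" w] A(3) by (simp add: pos_def_matrix_def ASu)
  have comm: "w \<bullet> u = u \<bullet> w" "(S *v u) \<bullet> u = u \<bullet> (S *v u)" by (rule inner_commute)+
  have "(w - S *v u) \<bullet> (A *v (w - S *v u)) = w \<bullet> (A *v w) - 2 * (u \<bullet> w) + u \<bullet> (S *v u)"
    unfolding matrix_vector_mult_diff_distrib inner_diff_left inner_diff_right ASu symA comm by simp
  then have "exp (- ((w - S *v u) \<bullet> (A *v (w - S *v u))) / 2)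
     = exp (u \<bullet> w - u \<bullet> (S *v u) / 2) * exp (- (w \<bullet> (A *v w)) / 2)"
    by (simp add: exp_add[symmetric] field_simps)
  then show ?thesis
    by (simp add: mvn_density_def A_def[symmetric] w_def diff_diff_add[symmetric])
qed

lemma nn_integral_mvn_tilt:
  fixes S :: "real^'n^'n" and f :: "real^'n \<Rightarrow> ennreal"
  assumes S: "pos_def_matrix S" and [measurable]: "f \<in> borel_measurable borel"
  shows "(\<integral>\<^sup>+y. f y \<partial>mvn (\<mu> + S *v u) S)
     = (\<integral>\<^sup>+y. ennreal (exp (u \<bullet> (y - \<mu>) - u \<bullet> (S *v u) / 2)) * f y \<partial>mvn \<mu> S)"
  using mvn_density_pos[OF S]
  by (simp add: mvn_def nn_integral_density mvn_density_tilt[OF S] ennreal_mult less_imp_le mult_ac)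

text \<open>Chernoff's bound with parameter 1. The tilted measure has total mass one, so the
  exponential of \<open>y $ j - \<mu> $ j - S $ j $ j / 2\<close> has mean one; Markov's inequality
  does the rest. An exponential rate suffices, and the bound does not depend on
  \<open>\<mu>\<close>.\<close>

lemma mvn_tail_le:
  fixes S :: "real^'n^'n"
  assumes S: "pos_def_matrix S"
  shows "measure (mvn \<mu> S) {y. t < y $ j - \<mu> $ j} \<le> exp (S $ j $ j / 2 - t)"
proof -
  interpret prob_space "mvn \<mu> S" by (rule prob_space_mvn[OF S])
  define u :: "real^'n" where "u = axis j 1"
  have uS: "u \<bullet> (S *v u) = S $ j $ j"
    by (simp add: u_def inner_axis' matrix_vector_mul_component inner_axis)
  interpret T: prob_space "mvn (\<mu> + S *v u) S" by (rule prob_space_mvn[OF S])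
  have "1 = (\<integral>\<^sup>+y. 1 \<partial>mvn (\<mu> + S *v u) S)" using T.emeasure_space_1 by simp
  also have "\<dots> = (\<integral>\<^sup>+y. ennreal (exp (y $ j - \<mu> $ j - S $ j $ j / 2)) \<partial>mvn \<mu> S)"
    by (subst nn_integral_mvn_tilt[OF S]) (auto simp: uS, auto simp: u_def inner_axis')
  also have "\<dots> \<ge> (\<integral>\<^sup>+y. ennreal (exp (t - S $ j $ j / 2)) * indicator {y. t < y $ j - \<mu> $ j} y \<partial>mvn \<mu> S)"
    by (intro nn_integral_mono) (auto simp: indicator_def)
  also have "(\<integral>\<^sup>+y. ennreal (exp (t - S $ j $ j / 2)) * indicator {y. t < y $ j - \<mu> $ j} y \<partial>mvn \<mu> S)
     = ennreal (exp (t - S $ j $ j / 2) * prob {y. t < y $ j - \<mu> $ j})"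
    by (subst nn_integral_cmult_indicator) (auto simp: emeasure_eq_measure ennreal_mult)
  finally have "exp (t - S $ j $ j / 2) * prob {y. t < y $ j - \<mu> $ j} \<le> 1" by simp
  then have "prob {y. t < y $ j - \<mu> $ j} \<le> 1 / exp (t - S $ j $ j / 2)"
    by (simp only: pos_le_divide_eq[OF exp_gt_zero] mult.commute)
  also have "\<dots> = exp (S $ j $ j / 2 - t)" using exp_minus[of "t - S $ j $ j / 2"] by (simp add: inverse_eq_divide)
  finally show ?thesis .
qed

text \<open>\<open>c\<close> is the minimum of the quadratic form on the unit sphere, attained by
  compactness; homogeneity extends the bound to all vectors.\<close>

lemma pos_def_matrix_coercive:
  fixes A :: "real^'n^'n"
  assumes "pos_def_matrix A"
  obtains c where "c > 0" "\<And>x. c * (x \<bullet> x) \<le> x \<bullet> (A *v x)"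
proof -
  have cont: "continuous_on (sphere 0 1) (\<lambda>x. x \<bullet> (A *v x))" by (intro continuous_intros)
  have "axis undefined 1 \<in> sphere (0::real^'n) 1" by (simp add: norm_axis_1)
  then have "sphere (0::real^'n) 1 \<noteq> {}" by blast
  from continuous_attains_inf[OF compact_sphere this cont] obtain z where z: "z \<in> sphere 0 1" "\<And>x. x \<in> sphere 0 1 \<Longrightarrow> z \<bullet> (A *v z) \<le> x \<bullet> (A *v x)" by blast
  have "z \<bullet> (A *v z) * (x \<bullet> x) \<le> x \<bullet> (A *v x)" for x
  proof (cases "x = 0")
    case False
    define v where "v = (1 / norm x) *\<^sub>R x"
    have x: "x = norm x *\<^sub>R v" and v: "v \<in> sphere 0 1" using False by (auto simp: v_def)
    have "z \<bullet> (A *v z) * (norm x)\<^sup>2 \<le> (v \<bullet> (A *v v)) * (norm x)\<^sup>2"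
      using z(2)[OF v] by (intro mult_right_mono) auto
    also have "\<dots> = x \<bullet> (A *v x)"
      by (subst (2 3) x) (simp add: matrix_vector_mult_scaleR power2_eq_square)
    finally show ?thesis by (simp add: power2_norm_eq_inner)
  qed simp
  moreover have "z \<noteq> 0" using z(1) by auto
  then have "z \<bullet> (A *v z) > 0" using assms by (auto simp: pos_def_matrix_def)
  ultimately show thesis using that by blast
qed

text \<open>Coercivity of the inverse matrix dominates the centred density by an isotropic Gaussian,
  whose integral over the slab factorises. The factor of coordinate \<open>i\<close> is at most
  \<open>d\<close> because the exponential is at most 1. The constant serves every mean and every
  width.\<close>

lemma mvn_slab_le:
  fixes S :: "real^'n^'n"
  assumes S: "pos_def_matrix S"
  obtains C where "C \<ge> 0" "\<And>\<mu> d. d \<ge> 0 \<Longrightarrow> measure (mvn \<mu> S) {y. y $ i - \<mu> $ i \<in> {-d..0}} \<le> C * d"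
proof -
  define K where "K = sqrt ((2 * pi) ^ CARD('n) * det S)"
  have K: "K > 0" using pos_def_matrix_det_pos[OF S] by (simp add: K_def)
  obtain c where c: "c > 0" "\<And>x. c * (x \<bullet> x) \<le> x \<bullet> (matrix_inv S *v x)"
    using pos_def_matrix_coercive[OF pos_def_matrix_inv(3)[OF S]] by blast
  define P where "P = sqrt (pi / (c / 2)) ^ (CARD('n) - 1)"
  have P: "P \<ge> 0" "ennreal (sqrt (pi / (c / 2))) ^ (CARD('n) - 1) = ennreal P"
    using c(1) by (auto simp: P_def ennreal_power)
  have "measure (mvn \<mu> S) {y. y $ i - \<mu> $ i \<in> {-d..0}} \<le> (P / K) * d" if d: "d \<ge> 0" for \<mu> d
  proof -
    interpret prob_space "mvn 0 S" by (rule prob_space_mvn[OF S])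
    have "{y. y $ i - \<mu> $ i \<in> {-d..0}} \<in> sets borel" by measurable
    then have "emeasure (mvn \<mu> S) {y. y $ i - \<mu> $ i \<in> {-d..0}} = emeasure (mvn 0 S) {x. x $ i \<in> {-d..0}}"
      using mvn_translate[of \<mu> 0 S] by (subst (asm) add_0_right) (simp add: emeasure_distr vimage_def)
    also have "\<dots> = (\<integral>\<^sup>+x. ennreal (mvn_density 0 S x) * indicator {x. x $ i \<in> {-d..0}} x \<partial>lborel)"
      unfolding mvn_def by (rule emeasure_density) auto
    also have "\<dots> \<le> (\<integral>\<^sup>+x. ennreal (1 / K) * (indicator {-d..0} (x $ i) * ennreal (exp (- (c / 2 * (x \<bullet> x))))) \<partial>lborel)"
    proof (rule nn_integral_mono)
      fix x :: "real^'n"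
      have "mvn_density 0 S x \<le> 1 / K * exp (- (c / 2 * (x \<bullet> x)))"
        using c(2)[of x] K unfolding mvn_density_def K_def[symmetric] by (simp add: divide_right_mono)
      then show "ennreal (mvn_density 0 S x) * indicator {x. x $ i \<in> {-d..0}} x
         \<le> ennreal (1 / K) * (indicator {-d..0} (x $ i) * ennreal (exp (- (c / 2 * (x \<bullet> x)))))"
        using K by (auto simp: indicator_def ennreal_mult[symmetric] intro!: ennreal_leI)
    qed
    also have "\<dots> = ennreal (1 / K) * ((\<integral>\<^sup>+t. indicator {-d..0} t * ennreal (exp (- (c / 2 * t\<^sup>2))) \<partial>lborel) * ennreal P)"
      using nn_integral_lborel_axis_cutoff[of "indicator {-d..0}" "c / 2" i, unfolded P(2)] c(1)
      by (subst nn_integral_cmult) auto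
    also have "\<dots> \<le> ennreal (1 / K) * (ennreal d * ennreal P)"
    proof (intro mult_left_mono mult_right_mono)
      have "(\<integral>\<^sup>+t. indicator {-d..0} t * ennreal (exp (- (c / 2 * t\<^sup>2))) \<partial>lborel) \<le> (\<integral>\<^sup>+t. indicator {-d..0} t \<partial>lborel)"
        using c(1) by (intro nn_integral_mono) (auto simp: indicator_def)
      also have "\<dots> = ennreal d" using d by simp
      finally show "(\<integral>\<^sup>+t. indicator {-d..0} t * ennreal (exp (- (c / 2 * t\<^sup>2))) \<partial>lborel) \<le> ennreal d" .
    qed auto
    also have "\<dots> = ennreal (P / K * d)" using K P(1) d by (simp add: ennreal_mult[symmetric])
    finally show ?thesis
      using K P(1) d prob_space.finite_measure[OF prob_space_mvn[OF S, of \<mu>]]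
      by (simp add: finite_measure.emeasure_eq_measure)
  qed
  moreover have "P / K \<ge> 0" using P K by simp
  ultimately show thesis using that by blast
qed

section \<open>Relative error of the control variate estimator\<close>

lemma shift_eq: "shift \<mu> S i \<gamma> = S *v axis i ((ln \<gamma> - \<mu> $ i) / S $ i $ i)"
  by (simp add: vec_eq_iff shift_def matrix_vector_mult_axis)

lemma likelihood_ratio_eq:
  fixes S :: "real^'n^'n" and i :: 'n
  assumes S: "pos_def_matrix S"
  defines "\<sigma> \<equiv> S $ i $ i"
  shows "likelihood_ratio \<mu> S i \<gamma> y
    = exp ((ln \<gamma> - \<mu> $ i)\<^sup>2 / (2 * \<sigma>) - (ln \<gamma> - \<mu> $ i) * (y $ i - \<mu> $ i) / \<sigma>)"
proof -
  define a where "a = ln \<gamma> - \<mu> $ i"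
  define u :: "real^'n" where "u = axis i (a / \<sigma>)"
  have \<sigma>: "\<sigma> > 0" unfolding \<sigma>_def by (rule pos_def_matrix_diag_pos[OF S])
  have u: "u \<bullet> (y - \<mu>) = a * (y $ i - \<mu> $ i) / \<sigma>" "u \<bullet> (S *v u) = a\<^sup>2 / \<sigma>"
    using \<sigma> by (simp_all add: u_def inner_axis' matrix_vector_mult_axis \<sigma>_def[symmetric] power2_eq_square)
  define x where "x = a\<^sup>2 / (2 * \<sigma>) - a * (y $ i - \<mu> $ i) / \<sigma>"
  have "mvn_density (\<mu> + shift \<mu> S i \<gamma>) S y = exp (- x) * mvn_density \<mu> S y"
    unfolding shift_eq a_def[symmetric] \<sigma>_def[symmetric] u_def[symmetric] mvn_density_tilt[OF S] u x_def by simp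
  then have "likelihood_ratio \<mu> S i \<gamma> y = exp x"
    using mvn_density_pos[OF S, of \<mu> y] by (simp add: likelihood_ratio_def exp_minus inverse_eq_divide)
  then show ?thesis by (simp only: x_def a_def)
qed

lemma variance_cv_estimator_le:
  fixes S :: "real^'n^'n"
  assumes S: "pos_def_matrix S" and \<gamma>: "\<gamma> > 0" and a: "ln \<gamma> \<le> \<mu> $ i"
  shows "prob_space.variance (proposal \<mu> S i \<gamma>) (cv_estimator \<mu> S i \<gamma>)
    \<le> (exp (- (ln \<gamma> - \<mu> $ i)\<^sup>2 / (2 * S $ i $ i)))\<^sup>2
       * measure (proposal \<mu> S i \<gamma>) {y. y $ i \<le> ln \<gamma> \<and> \<gamma> < (\<Sum>k\<in>UNIV. exp (y $ k))}"
proof -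
  define \<sigma> where "\<sigma> = S $ i $ i"
  have \<sigma>: "\<sigma> > 0" unfolding \<sigma>_def by (rule pos_def_matrix_diag_pos[OF S])
  define a where "a = ln \<gamma> - \<mu> $ i"
  define M where "M = exp (- a\<^sup>2 / (2 * \<sigma>))"
  define B where "B = {y::real^'n. y $ i \<le> ln \<gamma> \<and> \<gamma> < (\<Sum>k\<in>UNIV. exp (y $ k))}"
  define L where "L y = exp (a\<^sup>2 / (2 * \<sigma>) - a * (y $ i - \<mu> $ i) / \<sigma>)" for y :: "real^'n"
  define X where "X y = indicator B y * L y" for y
  define G where "G = proposal \<mu> S i \<gamma>"
  interpret prob_space G unfolding G_def proposal_def by (rule prob_space_mvn[OF S])
  have G[simp, measurable_cong]: "sets G = sets borel" by (simp add: G_def proposal_def)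
  have B[measurable]: "B \<in> sets borel" unfolding B_def by measurable
  have [measurable]: "X \<in> borel_measurable borel" unfolding X_def[abs_def] L_def by measurable
  have X: "0 \<le> X y" "X y \<le> M * indicator B y" for y
  proof -
    show "X y \<le> M * indicator B y"
    proof (cases "y \<in> B")
      case True
      \<comment> \<open>Since \<open>a \<le> 0\<close>, \<open>L\<close> is nondecreasing in
        \<open>y $ i\<close>; on \<open>B\<close> it is therefore at most its value at
        \<open>y $ i = ln \<gamma>\<close>, which is \<open>M\<close>.\<close>
      then have "y $ i - \<mu> $ i \<le> a" by (simp add: B_def a_def)
      moreover have "a \<le> 0" using a by (simp add: a_def)
      ultimately have "a * a \<le> a * (y $ i - \<mu> $ i)" by (intro mult_left_mono_neg)
      then have "a * a / \<sigma> \<le> a * (y $ i - \<mu> $ i) / \<sigma>" using \<sigma> by (intro divide_right_mono) auto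
      moreover have "a\<^sup>2 / (2 * \<sigma>) = a * a / \<sigma> / 2" by (simp add: power2_eq_square)
      moreover have "s / 2 - z \<le> - (s / 2)" if "s \<le> z" for s z :: real using that by simp
      ultimately have "a\<^sup>2 / (2 * \<sigma>) - a * (y $ i - \<mu> $ i) / \<sigma> \<le> - a\<^sup>2 / (2 * \<sigma>)"
        by (simp only: minus_divide_left[symmetric])
      then show ?thesis using True by (simp add: X_def L_def M_def)
    qed (simp add: X_def)
  qed (simp add: X_def L_def)
  have XM: "X y \<le> M" for y
    using X(2)[of y] by (cases "y \<in> B") (auto simp: M_def intro: order_trans[OF _ exp_ge_zero])
  have iX: "integrable G X"
    using X XM by (intro integrable_const_bound[of _ M]) auto
  have iX2: "integrable G (\<lambda>y. (X y)\<^sup>2)"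
  proof (intro integrable_const_bound[of _ "M\<^sup>2"])
    show "AE y in G. norm ((X y)\<^sup>2) \<le> M\<^sup>2" using X(1) XM by (auto intro!: AE_I2 power_mono)
  qed auto
  define m where "m = control_mean \<mu> S i \<gamma>"
  \<comment> \<open>One summand never exceeds the sum, so the event of the importance estimator lies
    inside that of the control variate, and the two indicators differ exactly on
    \<open>B\<close>.\<close>
  have cv: "cv_estimator \<mu> S i \<gamma> = (\<lambda>y. m - X y)"
  proof
    fix y :: "real^'n"
    have "exp (y $ i) \<le> (\<Sum>k\<in>UNIV. exp (y $ k))"
      by (rule member_le_sum) auto
    moreover have "exp (y $ i) \<le> \<gamma> \<longleftrightarrow> y $ i \<le> ln \<gamma>"
      using \<gamma> by (metis exp_le_cancel_iff exp_ln)
    ultimately show "cv_estimator \<mu> S i \<gamma> y = m - X y"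
      unfolding cv_estimator_def importance_estimator_def control_variate_def likelihood_ratio_eq[OF S]
        m_def[symmetric] a_def[symmetric] \<sigma>_def[symmetric] L_def[symmetric] X_def
      by (auto simp: B_def indicator_def)
  qed
  have "variance (cv_estimator \<mu> S i \<gamma>) = variance X"
    unfolding cv using iX by (simp add: prob_space power2_commute)
  also have "\<dots> \<le> expectation (\<lambda>y. (X y)\<^sup>2)"
    using variance_eq[OF iX iX2] by simp
  also have "\<dots> \<le> expectation (\<lambda>y. M\<^sup>2 * indicator B y)"
  proof (rule integral_mono[OF iX2])
    show "integrable G (\<lambda>y. M\<^sup>2 * indicator B y :: real)" by (intro integrable_mult_right integrable_real_indicator) (auto simp: emeasure_eq_measure)
    show "(X y)\<^sup>2 \<le> M\<^sup>2 * indicator B y" for y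
      using power_mono[OF X(2) X(1), of y 2] by (cases "y \<in> B") (auto simp: power_mult_distrib)
  qed
  also have "\<dots> = M\<^sup>2 * prob B"
    by simp
  finally show ?thesis by (simp add: G_def M_def B_def a_def \<sigma>_def)
qed

section \<open>Probability of the error set under the proposal\<close>

lemma proposal_error_set_le:
  fixes S :: "real^'n^'n"
  assumes S: "pos_def_matrix S" and \<epsilon>: "\<epsilon> > 0"
    and gap: "\<And>j. j \<noteq> i \<Longrightarrow> (1 + 2 * \<epsilon>) * S $ i $ i \<le> S $ j $ i"
  obtains C where "C \<ge> 0"
    "\<And>\<gamma>. \<lbrakk>\<gamma> > 0; exp (\<epsilon> * (ln \<gamma> - \<mu> $ i)) \<le> 1 / 2\<rbrakk> \<Longrightarrow>
      measure (proposal \<mu> S i \<gamma>) {y. y $ i \<le> ln \<gamma> \<and> \<gamma> < (\<Sum>k\<in>UNIV. exp (y $ k))}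
        \<le> C * exp (\<epsilon> * (ln \<gamma> - \<mu> $ i))"
proof -
  define \<sigma> where "\<sigma> = S $ i $ i"
  have \<sigma>: "\<sigma> > 0" unfolding \<sigma>_def by (rule pos_def_matrix_diag_pos[OF S])
  obtain D where D: "D \<ge> 0" "\<And>\<mu> d. d \<ge> 0 \<Longrightarrow> measure (mvn \<mu> S) {y. y $ i - \<mu> $ i \<in> {-d..0}} \<le> D * d"
    using mvn_slab_le[OF S] by blast
  define n where "n = real CARD('n)"
  have n: "n \<ge> 1" by (simp add: n_def Suc_leI)
  \<comment> \<open>\<open>d j\<close> is the threshold-free part of the lower bound
    \<open>d j - \<epsilon> * a\<close> for the tail level \<open>t j\<close> below.
    \<open>C\<close> adds the slab of width \<open>2 * \<delta>\<close> and one tail constant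
    \<open>K j\<close> per remaining coordinate.\<close>
  define d where "d j = \<mu> $ i - \<mu> $ j - ln n" for j
  define K where "K j = exp (S $ j $ j / 2 - d j)" for j
  define C where "C = 2 * D + (\<Sum>j\<in>UNIV - {i}. K j)"
  have "measure (proposal \<mu> S i \<gamma>) {y. y $ i \<le> ln \<gamma> \<and> \<gamma> < (\<Sum>k\<in>UNIV. exp (y $ k))}
        \<le> C * exp (\<epsilon> * (ln \<gamma> - \<mu> $ i))"
    if \<gamma>: "\<gamma> > 0" and small: "exp (\<epsilon> * (ln \<gamma> - \<mu> $ i)) \<le> 1 / 2" for \<gamma>
  proof -
    define a where "a = ln \<gamma> - \<mu> $ i"
    define m where "m = \<mu> + shift \<mu> S i \<gamma>"
    define \<delta> where "\<delta> = exp (\<epsilon> * a)"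
    have \<delta>: "0 < \<delta>" "\<delta> \<le> 1 / 2" using small by (auto simp: \<delta>_def a_def)
    have a0: "a \<le> 0"
    proof (rule ccontr)
      assume "\<not> a \<le> 0"
      then have "exp (\<epsilon> * a) > 1" using \<epsilon> by simp
      then show False using \<delta> unfolding \<delta>_def by linarith
    qed
    have mi: "m $ i = ln \<gamma>" using \<sigma> by (simp add: m_def shift_def \<sigma>_def)
    have mj: "m $ j = \<mu> $ j + S $ j $ i / \<sigma> * a" for j by (simp add: m_def shift_def \<sigma>_def a_def)
    interpret prob_space "mvn m S" by (rule prob_space_mvn[OF S])
    \<comment> \<open>Chosen so that \<open>y \<in> tail j\<close> means that
      \<open>exp (y $ j)\<close> exceeds \<open>\<gamma> * \<delta> / n\<close>.\<close>
    define t where "t j = ln \<gamma> + \<epsilon> * a - ln n - m $ j" for j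
    define slab where "slab = {y::real^'n. y $ i - m $ i \<in> {-(2 * \<delta>)..0}}"
    define tail where "tail j = {y::real^'n. t j < y $ j - m $ j}" for j
    have [measurable]: "slab \<in> sets borel" "tail j \<in> sets borel" for j
      unfolding slab_def tail_def by measurable
    \<comment> \<open>Budget argument: off the slab the i-th summand is at most
      \<open>\<gamma> * (1 - \<delta>)\<close>, and off the tails the others together use at most
      \<open>\<gamma> * \<delta>\<close>, so the sum cannot exceed \<open>\<gamma>\<close>.\<close>
    have cover: "{y. y $ i \<le> ln \<gamma> \<and> \<gamma> < (\<Sum>k\<in>UNIV. exp (y $ k))} \<subseteq> slab \<union> (\<Union>j\<in>UNIV - {i}. tail j)"
    proof (rule subsetI, rule ccontr)
      fix y :: "real^'n"
      assume y: "y \<in> {y. y $ i \<le> ln \<gamma> \<and> \<gamma> < (\<Sum>k\<in>UNIV. exp (y $ k))}"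
        and ny: "y \<notin> slab \<union> (\<Union>j\<in>UNIV - {i}. tail j)"
      have "y $ i \<le> ln \<gamma> - 2 * \<delta>" using y ny by (auto simp: slab_def mi)
      then have "exp (y $ i) \<le> \<gamma> / exp (2 * \<delta>)" using \<gamma> by (metis exp_diff exp_le_cancel_iff exp_ln)
      also have "\<dots> \<le> \<gamma> * (1 - \<delta>)"
      proof -
        \<comment> \<open>The product is 1 plus \<open>\<delta> * (1 - 2 * \<delta>)\<close>; this
          is where \<open>\<delta> \<le> 1 / 2\<close> enters.\<close>
        have "1 \<le> (1 - \<delta>) * (1 + 2 * \<delta>)" using \<delta> mult_left_mono[of \<delta> "1/2" \<delta>] by (simp add: algebra_simps)
        also have "\<dots> \<le> (1 - \<delta>) * exp (2 * \<delta>)"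
          using \<delta> by (intro mult_left_mono exp_ge_add_one_self) auto
        finally have "\<gamma> * 1 \<le> \<gamma> * ((1 - \<delta>) * exp (2 * \<delta>))" using \<gamma> by (intro mult_left_mono) auto
        then show ?thesis by (simp add: pos_divide_le_eq mult.assoc)
      qed
      finally have yi: "exp (y $ i) \<le> \<gamma> * (1 - \<delta>)" .
      have yj: "exp (y $ j) \<le> \<gamma> * \<delta> / n" if "j \<noteq> i" for j
      proof -
        have "y \<notin> tail j" using ny that by blast
        then have "y $ j \<le> ln \<gamma> + \<epsilon> * a - ln n" by (simp add: tail_def t_def)
        then have "exp (y $ j) \<le> exp (ln \<gamma> + \<epsilon> * a - ln n)" by simp
        also have "\<dots> = \<gamma> * \<delta> / n" using \<gamma> n by (simp add: exp_add exp_diff \<delta>_def)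
        finally show ?thesis .
      qed
      have "(\<Sum>k\<in>UNIV. exp (y $ k)) = exp (y $ i) + (\<Sum>k\<in>UNIV - {i}. exp (y $ k))"
        by (rule sum.remove) auto
      also have "(\<Sum>k\<in>UNIV - {i}. exp (y $ k)) \<le> (\<Sum>k\<in>UNIV - {i}. \<gamma> * \<delta> / n)"
        using yj by (intro sum_mono) auto
      also have "\<dots> \<le> (\<Sum>k\<in>(UNIV::'n set). \<gamma> * \<delta> / n)"
        using \<gamma> \<delta> n by (intro sum_mono2) auto
      also have "\<dots> = \<gamma> * \<delta>" using n by (simp add: n_def)
      finally show False using yi y by (simp add: algebra_simps)
    qed
    have "measure (mvn m S) {y. y $ i \<le> ln \<gamma> \<and> \<gamma> < (\<Sum>k\<in>UNIV. exp (y $ k))}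
       \<le> prob (slab \<union> (\<Union>j\<in>UNIV - {i}. tail j))"
      by (rule finite_measure_mono[OF cover]) simp
    also have "\<dots> \<le> prob slab + prob (\<Union>j\<in>UNIV - {i}. tail j)"
      by (rule measure_Un_le) auto
    also have "prob slab \<le> D * (2 * \<delta>)"
      unfolding slab_def using D(2)[of "2 * \<delta>" m] \<delta> by simp
    also have "prob (\<Union>j\<in>UNIV - {i}. tail j) \<le> (\<Sum>j\<in>UNIV - {i}. prob (tail j))"
      by (rule measure_UNION_le) auto
    also have "\<dots> \<le> (\<Sum>j\<in>UNIV - {i}. K j * \<delta>)"
    proof (rule sum_mono)
      fix j assume "j \<in> UNIV - {i}"
      \<comment> \<open>Of the margin \<open>2 * \<epsilon>\<close>, one \<open>\<epsilon>\<close>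
        pays for lowering the level from \<open>\<gamma>\<close> to
        \<open>\<gamma> * \<delta> / n\<close>; the other remains as the decay
        \<open>\<delta>\<close>.\<close>
      then have "1 + 2 * \<epsilon> \<le> S $ j $ i / \<sigma>" using gap[of j] \<sigma> by (simp add: field_simps \<sigma>_def)
      then have "S $ j $ i / \<sigma> * a \<le> (1 + 2 * \<epsilon>) * a" using a0 by (rule mult_right_mono_neg)
      then have "t j \<ge> d j - \<epsilon> * a"
        unfolding t_def d_def mj by (simp add: a_def algebra_simps)
      have "prob (tail j) \<le> exp (S $ j $ j / 2 - t j)" unfolding tail_def by (rule mvn_tail_le[OF S])
      also have "\<dots> \<le> exp (S $ j $ j / 2 - d j + \<epsilon> * a)" using \<open>t j \<ge> d j - \<epsilon> * a\<close> by simp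
      also have "\<dots> = K j * \<delta>" by (simp add: K_def \<delta>_def exp_add)
      finally show "prob (tail j) \<le> K j * \<delta>" .
    qed
    also have "D * (2 * \<delta>) + (\<Sum>j\<in>UNIV - {i}. K j * \<delta>) = C * \<delta>"
      by (simp add: C_def distrib_right sum_distrib_right)
    finally show ?thesis
      by (simp add: proposal_def m_def[symmetric] \<delta>_def a_def)
  qed
  moreover have "C \<ge> 0" using D(1) by (auto simp: C_def K_def intro!: add_nonneg_nonneg sum_nonneg)
  ultimately show thesis using that by blast
qed

section \<open>Lower bound for the left tail\<close>

lemma filterlim_at_bot_add_const:
  fixes f :: "'a \<Rightarrow> real"
  assumes "filterlim f at_bot F"
  shows "filterlim (\<lambda>x. f x + c) at_bot F"
proof -
  have "\<forall>\<^sub>F x in F. f x \<le> Z - c" for Z using assms by (simp add: filterlim_at_bot)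
  then show ?thesis by (simp add: filterlim_at_bot le_diff_eq)
qed

text \<open>The mean is tilted so that its i-th coordinate is
  \<open>ln \<gamma> - 2 * \<eta>\<close>. A ball of radius \<open>\<eta>\<close> around it
  eventually lies in the tail event and has mass \<open>q\<close> independent of
  \<open>\<gamma>\<close>; tilting back to \<open>\<mu>\<close> costs the exponential factors in the
  bound.\<close>

lemma left_tail_ge:
  fixes S :: "real^'n^'n"
  assumes S: "pos_def_matrix S" and \<eta>: "\<eta> > 0" and gap: "\<And>j. j \<noteq> i \<Longrightarrow> S $ i $ i < S $ j $ i"
  obtains p where "p > 0"
    "\<forall>\<^sub>F \<gamma> in at_right 0. p * exp (- (ln \<gamma> - \<mu> $ i)\<^sup>2 / (2 * S $ i $ i))
        * exp (3 * \<eta> / S $ i $ i * (ln \<gamma> - \<mu> $ i)) \<le> left_tail \<mu> S \<gamma>"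
proof -
  define \<sigma> where "\<sigma> = S $ i $ i"
  have \<sigma>: "\<sigma> > 0" unfolding \<sigma>_def by (rule pos_def_matrix_diag_pos[OF S])
  interpret prob_space "mvn 0 S" by (rule prob_space_mvn[OF S])
  define q where "q = prob (ball 0 \<eta>)"
  have q: "q > 0"
  proof -
    \<comment> \<open>The density vanishes nowhere, so a null ball would be Lebesgue null, which a
      nonempty open set is not.\<close>
    have nz: "\<not> mvn_density 0 S x \<le> 0" for x by (simp add: not_le mvn_density_pos[OF S])
    have "emeasure (mvn 0 S) (ball 0 \<eta>) \<noteq> 0"
    proof
      assume "emeasure (mvn 0 S) (ball 0 \<eta>) = 0"
      then have "ball 0 \<eta> \<in> null_sets (mvn 0 S)" by (simp add: null_sets_def)
      then have "AE x in lborel. x \<in> ball (0::real^'n) \<eta> \<longrightarrow> ennreal (mvn_density 0 S x) = 0"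
        unfolding mvn_def by (subst (asm) null_sets_density_iff) auto
      then have "AE x in lborel. x \<notin> ball (0::real^'n) \<eta>"
        by (simp add: ennreal_eq_0_iff nz)
      then have "ball (0::real^'n) \<eta> \<in> null_sets lborel"
        by (subst (asm) AE_iff_null_sets[symmetric]) auto
      moreover have "\<not> negligible (ball (0::real^'n) \<eta>)"
        using \<eta> by (intro open_not_negligible) auto
      ultimately show False
        by (simp add: negligible_iff_null_sets null_sets_completion_iff)
    qed
    then show ?thesis by (simp add: q_def emeasure_eq_measure zero_less_measure_iff)
  qed
  define c where "c j = S $ j $ i / \<sigma>" for j
  have c: "c j > 1" if "j \<noteq> i" for j using gap[OF that] \<sigma> by (simp add: c_def \<sigma>_def)
  define p where "p = exp (- 4 * \<eta>\<^sup>2 / \<sigma>) * q"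
  have p: "p > 0" using q by (simp add: p_def)
  \<comment> \<open>On the ball used below, the summands other than the i-th total at most
    \<open>\<gamma> * r a\<close>: the exponent is
    \<open>\<mu> $ j + c j * (a - 2 * \<eta>) + \<eta> - ln \<gamma>\<close>. It tends to minus
    infinity with \<open>a\<close> because \<open>c j > 1\<close>.\<close>
  define r where "r a = (\<Sum>j\<in>UNIV - {i}. exp ((c j - 1) * a + (\<mu> $ j - \<mu> $ i - 2 * c j * \<eta> + \<eta>)))" for a
  have "(r \<longlongrightarrow> (\<Sum>j\<in>UNIV - {i}. 0)) at_bot"
    unfolding r_def
  proof (rule tendsto_sum)
    fix j assume "j \<in> UNIV - {i}"
    then have "0 < c j - 1" using c[of j] by simp
    then have "filterlim (\<lambda>a. (c j - 1) * a) at_bot at_bot"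
      by (rule filterlim_tendsto_pos_mult_at_bot[OF tendsto_const _ filterlim_ident])
    then have "filterlim (\<lambda>a. (\<mu> $ j - \<mu> $ i - 2 * c j * \<eta> + \<eta>) + (c j - 1) * a) at_bot at_bot"
      by (subst add.commute) (rule filterlim_at_bot_add_const)
    then show "((\<lambda>a. exp ((c j - 1) * a + (\<mu> $ j - \<mu> $ i - 2 * c j * \<eta> + \<eta>))) \<longlongrightarrow> 0) at_bot"
      by (intro filterlim_compose[OF exp_at_bot]) (simp add: add.commute)
  qed
  then have ev: "\<forall>\<^sub>F a in at_bot. r a < 1 - exp (- \<eta>)"
    using \<eta> by (intro order_tendstoD(2)) auto
  have lim: "filterlim (\<lambda>\<gamma>. ln \<gamma> - \<mu> $ i) at_bot (at_right 0)"
    using filterlim_at_bot_add_const[OF ln_at_0, of "- \<mu> $ i"] by simp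
  have "\<forall>\<^sub>F \<gamma> in at_right (0::real). 0 < \<gamma>" by (simp add: eventually_at_filter)
  moreover have "\<forall>\<^sub>F \<gamma> in at_right 0. r (ln \<gamma> - \<mu> $ i) < 1 - exp (- \<eta>)"
    using lim ev unfolding filterlim_iff by blast
  moreover have "\<forall>\<^sub>F \<gamma> in at_right 0. ln \<gamma> - \<mu> $ i \<le> 0"
    using lim eventually_le_at_bot[of 0] unfolding filterlim_iff by blast
  ultimately have "\<forall>\<^sub>F \<gamma> in at_right 0. p * exp (- (ln \<gamma> - \<mu> $ i)\<^sup>2 / (2 * \<sigma>))
        * exp (3 * \<eta> / \<sigma> * (ln \<gamma> - \<mu> $ i)) \<le> left_tail \<mu> S \<gamma>"
  proof eventually_elim
    case (elim \<gamma>)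
    define a where "a = ln \<gamma> - \<mu> $ i"
    have a: "a \<le> 0" "r a < 1 - exp (- \<eta>)" and \<gamma>: "\<gamma> > 0" using elim by (auto simp: a_def)
    \<comment> \<open>One \<open>\<eta>\<close> absorbs the radius of the ball; the other keeps the
      i-th summand below \<open>\<gamma> * exp (- \<eta>)\<close>, leaving room for the
      rest.\<close>
    define t where "t = a - 2 * \<eta>"
    define u :: "real^'n" where "u = axis i (t / \<sigma>)"
    define m where "m = \<mu> + S *v u"
    define A where "A = {y::real^'n. (\<Sum>k\<in>UNIV. exp (y $ k)) \<le> \<gamma>}"
    have A[measurable]: "A \<in> sets borel" unfolding A_def by measurable
    have uw: "u \<bullet> w = t / \<sigma> * w $ i" for w by (simp add: u_def inner_axis')
    have uS: "u \<bullet> (S *v u) = t\<^sup>2 / \<sigma>"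
      using \<sigma> by (simp add: uw) (simp add: u_def matrix_vector_mult_axis \<sigma>_def[symmetric] power2_eq_square)
    have Su: "S *v (- u) = - (S *v u)" by (rule linear_neg[OF matrix_vector_mul_linear])
    have tilt: "(- u) \<bullet> w = - t / \<sigma> * w $ i" "(- u) \<bullet> (S *v (- u)) = t\<^sup>2 / \<sigma>" for w
      by (simp add: uw) (simp only: Su inner_minus_left inner_minus_right minus_minus uS)
    have mk: "m $ k = \<mu> $ k + c k * t" for k by (simp add: m_def u_def matrix_vector_mult_axis c_def)
    have ci: "c i = 1" using \<sigma> by (simp add: c_def \<sigma>_def)
    interpret mu: prob_space "mvn \<mu> S" by (rule prob_space_mvn[OF S])
    interpret m: prob_space "mvn m S" by (rule prob_space_mvn[OF S])
    have comp: "\<bar>(y - m) $ k\<bar> < \<eta>" if "y \<in> ball m \<eta>" for y k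
      using component_le_norm_cart[of "y - m" k] that by (simp add: dist_norm norm_minus_commute)
    have sub: "ball m \<eta> \<subseteq> A"
    proof
      fix y assume y: "y \<in> ball m \<eta>"
      have yk: "y $ k \<le> \<mu> $ k + c k * t + \<eta>" for k using comp[OF y, of k] by (simp add: mk)
      have yi: "exp (y $ i) \<le> \<gamma> * exp (- \<eta>)"
      proof -
        have "y $ i \<le> ln \<gamma> + (- \<eta>)" using yk[of i] by (simp add: ci t_def a_def)
        then show ?thesis using \<gamma> by (metis exp_add exp_le_cancel_iff exp_ln)
      qed
      have yj: "exp (y $ j) \<le> \<gamma> * exp ((c j - 1) * a + (\<mu> $ j - \<mu> $ i - 2 * c j * \<eta> + \<eta>))" for j
      proof -
        have "y $ j \<le> ln \<gamma> + ((c j - 1) * a + (\<mu> $ j - \<mu> $ i - 2 * c j * \<eta> + \<eta>))"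
          using yk[of j] by (simp add: t_def a_def algebra_simps)
        then show ?thesis using \<gamma> by (metis exp_add exp_le_cancel_iff exp_ln)
      qed
      have "(\<Sum>k\<in>UNIV. exp (y $ k)) = exp (y $ i) + (\<Sum>k\<in>UNIV - {i}. exp (y $ k))"
        by (rule sum.remove) auto
      also have "\<dots> \<le> \<gamma> * exp (- \<eta>) + (\<Sum>j\<in>UNIV - {i}. \<gamma> * exp ((c j - 1) * a + (\<mu> $ j - \<mu> $ i - 2 * c j * \<eta> + \<eta>)))"
        by (intro add_mono sum_mono yi yj)
      also have "\<dots> = \<gamma> * (exp (- \<eta>) + r a)" by (simp add: r_def sum_distrib_left distrib_left)
      also have "\<dots> \<le> \<gamma> * 1" using a(2) \<gamma> by (intro mult_left_mono) auto
      finally show "y \<in> A" by (simp add: A_def)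
    qed
    have "emeasure (mvn m S) (ball m \<eta>) = emeasure (mvn 0 S) (ball 0 \<eta>)"
    proof -
      have "(+) m -` ball m \<eta> = ball 0 \<eta>" by (auto simp: dist_norm)
      then show ?thesis using mvn_translate[of m 0 S] by (subst (asm) add_0_right) (simp add: emeasure_distr)
    qed
    then have mq: "m.prob (ball m \<eta>) = q" by (simp add: q_def m.emeasure_eq_measure emeasure_eq_measure)
    \<comment> \<open>A lower bound on the ball for the density of \<open>mvn \<mu> S\<close>
      relative to \<open>mvn m S\<close>: this ratio is the tilt by \<open>- u\<close>, and as
      \<open>t \<le> 0\<close> it decreases when \<open>(y - m) $ i\<close> falls towards
      \<open>- \<eta>\<close>.\<close>
    define E where "E = exp (t * \<eta> / \<sigma> - t\<^sup>2 / (2 * \<sigma>))"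
    have "ennreal (E * q) = (\<integral>\<^sup>+y. ennreal E * indicator (ball m \<eta>) y \<partial>mvn m S)"
      using q by (subst nn_integral_cmult_indicator) (auto simp: m.emeasure_eq_measure mq E_def ennreal_mult)
    also have "\<dots> \<le> (\<integral>\<^sup>+y. ennreal (exp ((- u) \<bullet> (y - m) - (- u) \<bullet> (S *v (- u)) / 2)) * indicator A y \<partial>mvn m S)"
    proof (rule nn_integral_mono)
      fix y
      show "ennreal E * indicator (ball m \<eta>) y \<le> ennreal (exp ((- u) \<bullet> (y - m) - (- u) \<bullet> (S *v (- u)) / 2)) * indicator A y"
      proof (cases "y \<in> ball m \<eta>")
        case True
        have "t \<le> 0" using a(1) \<eta> by (simp add: t_def)
        then have "- t / \<sigma> * (y - m) $ i \<ge> - t / \<sigma> * (- \<eta>)"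
          using comp[OF True, of i] \<sigma> by (intro mult_left_mono) (auto simp: divide_le_0_iff)
        then have "E \<le> exp ((- u) \<bullet> (y - m) - (- u) \<bullet> (S *v (- u)) / 2)"
          unfolding E_def tilt(2) tilt(1)[of "y - m"] by simp
        then show ?thesis using True sub by (auto simp: ennreal_leI)
      qed simp
    qed
    also have "\<dots> = (\<integral>\<^sup>+y. indicator A y \<partial>mvn (m + S *v (- u)) S)"
      by (subst nn_integral_mvn_tilt[OF S]) auto
    also have "m + S *v (- u) = \<mu>" by (simp add: m_def Su)
    also have "(\<integral>\<^sup>+y. indicator A y \<partial>mvn \<mu> S) = ennreal (left_tail \<mu> S \<gamma>)"
      by (simp add: mu.emeasure_eq_measure left_tail_def A_def[symmetric])
    finally have "E * q \<le> left_tail \<mu> S \<gamma>" by (simp add: left_tail_def)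
    \<comment> \<open>Expanding \<open>t = a - 2 * \<eta>\<close> yields the loss rate
      \<open>3 * \<eta> / \<sigma>\<close> and the constant that was put into
      \<open>p\<close>.\<close>
    moreover have "t * \<eta> / \<sigma> - t\<^sup>2 / (2 * \<sigma>) = - 4 * \<eta>\<^sup>2 / \<sigma> + (- a\<^sup>2 / (2 * \<sigma>) + 3 * \<eta> / \<sigma> * a)"
      using \<sigma> by (simp add: t_def field_simps power2_eq_square)
    then have "E * q = p * exp (- a\<^sup>2 / (2 * \<sigma>)) * exp (3 * \<eta> / \<sigma> * a)"
      by (simp only: E_def p_def exp_add) simp
    ultimately show ?case by (simp add: a_def)
  qed
  then show thesis using that p unfolding \<sigma>_def by blast
qed

section \<open>Combination: the relative error tends to zero\<close>

theorem theorem1: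
  fixes \<mu> :: "real^'n" and S :: "real^'n^'n" and i :: 'n
  assumes "pos_def_matrix S"
    and "\<And>j. j \<noteq> i \<Longrightarrow> sqrt (S $ i $ i) < correlation S i j * sqrt (S $ j $ j)"
  shows "Limsup (at_right 0)
           (\<lambda>\<gamma>. ereal (prob_space.variance (proposal \<mu> S i \<gamma>) (cv_estimator \<mu> S i \<gamma>)
                        / (left_tail \<mu> S \<gamma>)\<^sup>2)) = 0"
proof -
  note S = assms(1)
  define \<sigma> where "\<sigma> = S $ i $ i"
  have \<sigma>: "\<sigma> > 0" unfolding \<sigma>_def by (rule pos_def_matrix_diag_pos[OF S])
  \<comment> \<open>The factor \<open>sqrt (S $ j $ j)\<close> cancels in the correlation
    hypothesis, which thus compares a covariance with the variance of coordinate
    \<open>i\<close>.\<close>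
  have gap: "\<sigma> < S $ j $ i" if "j \<noteq> i" for j
  proof -
    have Sj: "0 < S $ j $ j" by (rule pos_def_matrix_diag_pos[OF S])
    have "transpose S $ i $ j = S $ i $ j" using S by (simp add: pos_def_matrix_def)
    then have sym: "S $ j $ i = S $ i $ j" by (simp add: transpose_def)
    have "sqrt \<sigma> < S $ i $ j / sqrt \<sigma>"
      using assms(2)[OF that] Sj by (simp add: correlation_def real_sqrt_mult \<sigma>_def)
    then show ?thesis using \<sigma> by (simp add: pos_less_divide_eq sym)
  qed
  \<comment> \<open>The element 1 keeps the set nonempty in dimension one, so that
    \<open>Min\<close> is meaningful; halving the minimum provides the margin
    \<open>2 * \<epsilon>\<close>.\<close>
  define J where "J = insert 1 ((\<lambda>j. S $ j $ i / \<sigma> - 1) ` (UNIV - {i}))"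
  have J: "finite J" "J \<noteq> {}" by (auto simp: J_def)
  define \<epsilon> where "\<epsilon> = Min J / 2"
  have \<epsilon>: "\<epsilon> > 0"
    using J gap \<sigma> by (auto simp: \<epsilon>_def Min_gr_iff J_def field_simps)
  have gap2: "(1 + 2 * \<epsilon>) * S $ i $ i \<le> S $ j $ i" if "j \<noteq> i" for j
  proof -
    have "S $ j $ i / \<sigma> - 1 \<in> J" using that by (auto simp: J_def)
    then have "2 * \<epsilon> \<le> S $ j $ i / \<sigma> - 1" using Min_le[OF J(1)] by (simp add: \<epsilon>_def)
    then show ?thesis using \<sigma> by (simp add: field_simps \<sigma>_def)
  qed
  obtain C where C: "C \<ge> 0" "\<And>\<gamma>. \<lbrakk>\<gamma> > 0; exp (\<epsilon> * (ln \<gamma> - \<mu> $ i)) \<le> 1 / 2\<rbrakk> \<Longrightarrow>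
      measure (proposal \<mu> S i \<gamma>) {y. y $ i \<le> ln \<gamma> \<and> \<gamma> < (\<Sum>k\<in>UNIV. exp (y $ k))}
        \<le> C * exp (\<epsilon> * (ln \<gamma> - \<mu> $ i))"
    using proposal_error_set_le[OF S \<epsilon> gap2] by blast
  define \<eta> where "\<eta> = \<epsilon> * \<sigma> / 12" \<comment> \<open>makes the exponential loss in the left tail bound \<open>exp (\<epsilon> a / 4)\<close>\<close>
  have \<eta>: "\<eta> > 0" using \<epsilon> \<sigma> by (simp add: \<eta>_def)
  have \<eta>': "3 * \<eta> / \<sigma> = \<epsilon> / 4" using \<sigma> by (simp add: \<eta>_def)
  obtain p where p: "p > 0" "\<forall>\<^sub>F \<gamma> in at_right 0. p * exp (- (ln \<gamma> - \<mu> $ i)\<^sup>2 / (2 * \<sigma>))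
        * exp (\<epsilon> / 4 * (ln \<gamma> - \<mu> $ i)) \<le> left_tail \<mu> S \<gamma>"
    using left_tail_ge[OF S \<eta>, of i \<mu>] gap unfolding \<sigma>_def[symmetric] \<eta>' by blast
  define V where "V \<gamma> = prob_space.variance (proposal \<mu> S i \<gamma>) (cv_estimator \<mu> S i \<gamma>)" for \<gamma>
  have lim: "filterlim (\<lambda>\<gamma>. ln \<gamma> - \<mu> $ i) at_bot (at_right 0)"
    using filterlim_at_bot_add_const[OF ln_at_0, of "- \<mu> $ i"] by simp
  have exp_lim: "((\<lambda>\<gamma>. exp (e * (ln \<gamma> - \<mu> $ i))) \<longlongrightarrow> 0) (at_right 0)" if "e > 0" for e
    by (intro filterlim_compose[OF exp_at_bot]
        filterlim_tendsto_pos_mult_at_bot[OF tendsto_const that lim])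
  have "\<forall>\<^sub>F \<gamma> in at_right (0::real). 0 < \<gamma>" by (simp add: eventually_at_filter)
  moreover have "\<forall>\<^sub>F \<gamma> in at_right 0. exp (\<epsilon> * (ln \<gamma> - \<mu> $ i)) < 1 / 2"
    using exp_lim[OF \<epsilon>] by (intro order_tendstoD(2)) auto
  moreover have "\<forall>\<^sub>F \<gamma> in at_right 0. ln \<gamma> - \<mu> $ i \<le> 0"
    using lim eventually_le_at_bot[of 0] unfolding filterlim_iff by blast
  ultimately have upper: "\<forall>\<^sub>F \<gamma> in at_right 0. V \<gamma> / (left_tail \<mu> S \<gamma>)\<^sup>2 \<le> C / p\<^sup>2 * exp (\<epsilon> / 2 * (ln \<gamma> - \<mu> $ i))"
    using p(2)
  proof eventually_elim
    case (elim \<gamma>)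
    define a where "a = ln \<gamma> - \<mu> $ i"
    define M where "M = exp (- a\<^sup>2 / (2 * \<sigma>))"
    \<comment> \<open>In terms of \<open>x\<close> the variance is at most \<open>C\<close> times
      the square of \<open>M\<close> times \<open>x ^ 4\<close>, while the left tail is at least
      \<open>p * M * x\<close>; \<open>M\<close> cancels and two powers of \<open>x\<close>
      remain.\<close>
    define x where "x = exp (\<epsilon> / 4 * a)"
    have pos: "M > 0" "x > 0" by (auto simp: M_def x_def)
    have x4: "exp (\<epsilon> * a) = x ^ 4" "exp (\<epsilon> / 2 * a) = x ^ 2"
      by (simp_all add: x_def exp_of_nat_mult[symmetric])
    have "V \<gamma> \<le> M\<^sup>2 * (C * x ^ 4)"
    proof -
      have "V \<gamma> \<le> M\<^sup>2 * measure (proposal \<mu> S i \<gamma>) {y. y $ i \<le> ln \<gamma> \<and> \<gamma> < (\<Sum>k\<in>UNIV. exp (y $ k))}"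
        using variance_cv_estimator_le[OF S, of \<gamma> \<mu> i] elim by (simp add: V_def M_def a_def \<sigma>_def)
      also have "\<dots> \<le> M\<^sup>2 * (C * x ^ 4)"
        using C(2)[of \<gamma>] elim by (intro mult_left_mono) (auto simp: x4(1)[symmetric] a_def)
      finally show ?thesis .
    qed
    moreover have "(p * M * x)\<^sup>2 \<le> (left_tail \<mu> S \<gamma>)\<^sup>2"
      using elim p(1) pos by (intro power_mono) (auto simp: M_def x_def a_def)
    ultimately have "V \<gamma> / (left_tail \<mu> S \<gamma>)\<^sup>2 \<le> (M\<^sup>2 * (C * x ^ 4)) / (p * M * x)\<^sup>2"
      using C(1) pos p(1) by (intro frac_le) auto
    also have "\<dots> = C / p\<^sup>2 * x ^ 2"
      using pos p(1) by (simp add: field_simps power2_eq_square power4_eq_xxxx)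
    finally show ?case unfolding x4(2)[symmetric] a_def .
  qed
  have lower: "\<forall>\<^sub>F \<gamma> in at_right 0. 0 \<le> V \<gamma> / (left_tail \<mu> S \<gamma>)\<^sup>2"
    by (intro always_eventually allI) (simp add: V_def integral_nonneg_AE)
  have bound: "((\<lambda>\<gamma>. C / p\<^sup>2 * exp (\<epsilon> / 2 * (ln \<gamma> - \<mu> $ i))) \<longlongrightarrow> 0) (at_right 0)"
    by (rule tendsto_mult_right_zero[OF exp_lim[OF half_gt_zero[OF \<epsilon>]]])
  have "((\<lambda>\<gamma>. V \<gamma> / (left_tail \<mu> S \<gamma>)\<^sup>2) \<longlongrightarrow> 0) (at_right 0)"
    by (rule tendsto_sandwich[OF lower upper tendsto_const bound])
  then have "((\<lambda>\<gamma>. ereal (V \<gamma> / (left_tail \<mu> S \<gamma>)\<^sup>2)) \<longlongrightarrow> 0) (at_right 0)"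
    by (simp add: zero_ereal_def)
  then show ?thesis unfolding V_def by (intro lim_imp_Limsup) simp
qed

end
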